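(* Let $X$ be a topological space, let $Y$ be a convex set in a topological vector space and let $Z$ be a nonempty set. Let $P:X\to 2^{Z}$, $Q:Y\to 2^{Z}$ and $T:Y\to 2^{X}$ be correspondences satisfying: (a) for each $x\in X$, there exists $y\in Y$ such that $P(x)\cap Q(y)\neq\emptyset$; (b) for each $x\in X$ and $y\in Y$ such that $P(x)\cap Q(y)\neq\emptyset$, there exist $y'\in Y$ and a neighborhood $U$ of $x$ such that $P(x')\cap Q(y')\neq\emptyset$ for each $x'\in U$; (c) $T\in KKM(Y,X)$ is compact. Then there exist an integer $n\ge 2$, points $y_1^{\ast},\dots,y_n^{\ast}\in Y$, a point $y^{\ast}\in\operatorname{co}\{y_1^{\ast},\dots,y_n^{\ast}\}$ and $x^{\ast}\in T(y^{\ast})$ such that $P(x^{\ast})\cap Q(y_i^{\ast})\neq\emptyset$ for each $i\in\{1,\dots,n\}$.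
   Context: A correspondence $T:Y\to 2^{X}$ assigns to each $y\in Y$ a subset $T(y)\subset X$; $T(B)=\bigcup_{y\in B}T(y)$ for $B\subset Y$. $T$ is compact if $\overline{T(Y)}$ is a compact subset of $X$. $\operatorname{co}$ denotes the convex hull. Given $T,H:Y\to 2^{X}$, $H$ is a generalized KKM mapping w.r.t. $T$ if $T(\operatorname{co}B)\subset H(B)$ for each finite $B\subset Y$. $KKM(Y,X)$ is the set of $T:Y\to 2^{X}$ having the KKM property: for every $H:Y\to 2^{X}$ which is a generalized KKM mapping w.r.t. $T$, the family $\{\overline{H(y)}:y\in Y\}$ has the finite intersection property. *)

theory Defs
  imports "HOL-Analysis.Analysis"
begin

text \<open>Real topological vector spaces, not assumed Hausdorff or locally convex; a complex
  topological vector space is one by restriction of scalars.\<close>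

class real_tvs = real_vector + topological_ab_group_add +
  assumes tendsto_scaleR_Pair:
    "LIM p (nhds (r::real) \<times>\<^sub>F nhds a). fst p *\<^sub>R snd p :> nhds (r *\<^sub>R a)"

instance real_normed_vector < real_tvs
proof
  fix r :: real and a :: 'a
  show "LIM p (nhds r \<times>\<^sub>F nhds a). fst p *\<^sub>R snd p :> nhds (r *\<^sub>R a)"
    by (intro tendsto_scaleR filterlim_fst filterlim_snd)
qed

text \<open>A correspondence from \<open>Y\<close> to the subsets of \<open>'x\<close> is a function
  \<open>'y \<Rightarrow> 'x set\<close> (empty values allowed) of which only the values on \<open>Y\<close> matter.\<close>

definition compact_correspondence ::
    "'y set \<Rightarrow> ('y \<Rightarrow> 'x::topological_space set) \<Rightarrow> bool" where
  "compact_correspondence Y T \<longleftrightarrow> compact (closure (\<Union>y\<in>Y. T y))"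

definition generalized_KKM ::
    "'y::real_vector set \<Rightarrow> ('y \<Rightarrow> 'x set) \<Rightarrow> ('y \<Rightarrow> 'x set) \<Rightarrow> bool" where
  "generalized_KKM Y T H \<longleftrightarrow>
     (\<forall>B. finite B \<and> B \<subseteq> Y \<longrightarrow> (\<Union>y\<in>convex hull B. T y) \<subseteq> (\<Union>y\<in>B. H y))"

text \<open>The empty subfamily is harmless: its intersection is \<open>UNIV\<close>, which is nonempty.\<close>

definition finite_intersection_property :: "'x set set \<Rightarrow> bool" where
  "finite_intersection_property \<F> \<longleftrightarrow>
     (\<forall>\<G>. finite \<G> \<and> \<G> \<subseteq> \<F> \<longrightarrow> \<Inter>\<G> \<noteq> {})"

definition KKM ::
    "'y::real_vector set \<Rightarrow> ('y \<Rightarrow> 'x::topological_space set) set" where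
  "KKM Y = {T. \<forall>H. generalized_KKM Y T H \<longrightarrow>
     finite_intersection_property {closure (H y) | y. y \<in> Y}}"

end

theory Submission
  imports Defs
begin

text \<open>Suppose that the conclusion fails, and let \<open>H y\<close> collect the values \<open>x\<close> of \<open>T\<close> for which
  \<open>P x\<close> misses \<open>Q y\<close>. A point of \<open>T(co B)\<close> outside \<open>H(B)\<close>, for a finite \<open>B \<subseteq> Y\<close>, would be exactly a
  point \<open>x\<^sup>*\<close> as wanted, with the elements of \<open>B\<close> as the points \<open>y\<^sub>i\<^sup>*\<close>; it is a value of \<open>T\<close> on
  \<open>Y\<close> because \<open>co B \<subseteq> Y\<close> by convexity. So failure of the conclusion says
  that \<open>H\<close> is a generalized KKM mapping with respect to \<open>T\<close>. The KKM property then makes the closures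
  of the sets \<open>H y\<close> have the finite intersection property, and compactness of \<open>T\<close> provides one point
  \<open>x\<close> common to all of them (\<open>KKM_compact_common_point\<close>). But by the first two
  hypotheses on \<open>P\<close> and \<open>Q\<close> some \<open>H y'\<close> avoids a whole neighbourhood of \<open>x\<close>, so that \<open>x\<close> is not in its
  closure. The bound \<open>n \<ge> 2\<close> costs nothing because the \<open>y\<^sub>i\<^sup>*\<close> may repeat
  (\<open>finite_enumeration_at_least_two\<close>).\<close>

lemma finite_enumeration_at_least_two:
  assumes "finite B" "B \<noteq> {}"
  obtains n :: nat and f where "n \<ge> 2" "f ` {1..n} = B"
proof -
  obtain h where h: "bij_betw h {1..card B} B"
    using ex_bij_betw_nat_finite_1[OF \<open>finite B\<close>] by blast
  have pos: "card B \<ge> 1"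
    using assms by (simp add: Suc_le_eq card_gt_0_iff)
  \<comment> \<open>Listing the first element once more at the end yields length at least two even for a singleton.\<close>
  define f where "f = h(Suc (card B) := h 1)"
  have "f ` {1..Suc (card B)} = insert (h 1) (h ` {1..card B})"
    by (auto simp: f_def atLeastAtMostSuc_conv)
  also have "\<dots> = B"
    using h pos by (auto simp: bij_betw_def)
  finally show thesis
    using pos by (intro that[of "Suc (card B)" f]) auto
qed

text \<open>The inclusion hypothesis puts every closure inside the compact set
  \<open>closure (\<Union>y\<in>Y. T y)\<close>, where closed sets with the finite intersection property share a point.\<close>

lemma KKM_compact_common_point:
  fixes Y :: "'y::real_vector set" and T H :: "'y \<Rightarrow> 'x::topological_space set"
  assumes "T \<in> KKM Y" "compact_correspondence Y T" "generalized_KKM Y T H"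
    and "Y \<noteq> {}"
    and sub: "\<And>y. y \<in> Y \<Longrightarrow> H y \<subseteq> (\<Union>y\<in>Y. T y)"
  obtains x where "\<And>y. y \<in> Y \<Longrightarrow> x \<in> closure (H y)"
proof -
  let ?K = "closure (\<Union>y\<in>Y. T y)"
  let ?F = "{closure (H y) | y. y \<in> Y}"
  obtain y0 where y0: "y0 \<in> Y"
    using \<open>Y \<noteq> {}\<close> by blast
  have fip: "finite_intersection_property ?F"
    using assms(1,3) unfolding KKM_def by blast
  have "?K \<inter> \<Inter>?F \<noteq> {}"
  proof (rule compact_imp_fip)
    show "compact ?K"
      using assms(2) by (simp add: compact_correspondence_def)
    show "closed C" if "C \<in> ?F" for C
      using that by auto
    fix G assume G: "finite G" "G \<subseteq> ?F"
    \<comment> \<open>The extra member keeps the intersection inside the compact set when \<open>G\<close> is empty.\<close>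
    let ?G = "insert (closure (H y0)) G"
    have "finite ?G" "?G \<subseteq> ?F"
      using G y0 by auto
    then have "\<Inter>?G \<noteq> {}"
      using fip unfolding finite_intersection_property_def by blast
    moreover have "closure (H y0) \<subseteq> ?K"
      by (rule closure_mono[OF sub[OF y0]])
    ultimately show "?K \<inter> \<Inter>G \<noteq> {}"
      by auto
  qed
  then show thesis
    using that by blast
qed

theorem theorem12:
  fixes Y :: "'y::real_tvs set"
    and P :: "'x::topological_space \<Rightarrow> 'z set"
    and Q :: "'y \<Rightarrow> 'z set"
    and T :: "'y \<Rightarrow> 'x set"
  assumes "convex Y"
    and "\<forall>x. \<exists>y\<in>Y. P x \<inter> Q y \<noteq> {}"
    and "\<forall>x. \<forall>y\<in>Y. P x \<inter> Q y \<noteq> {} \<longrightarrow>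
           (\<exists>y'\<in>Y. \<exists>U. x \<in> interior U \<and> (\<forall>x'\<in>U. P x' \<inter> Q y' \<noteq> {}))"
    and "T \<in> KKM Y"
    and "compact_correspondence Y T"
  shows "\<exists>(n::nat) (ys :: nat \<Rightarrow> 'y). n \<ge> 2 \<and> (\<forall>i\<in>{1..n}. ys i \<in> Y) \<and>
           (\<exists>y\<in>convex hull (ys ` {1..n}). \<exists>x\<in>T y. \<forall>i\<in>{1..n}. P x \<inter> Q (ys i) \<noteq> {})"
proof (rule ccontr)
  assume contra: "\<not> ?thesis"
  define H where "H y = {x \<in> (\<Union>y\<in>Y. T y). P x \<inter> Q y = {}}" for y
  have "generalized_KKM Y T H"
    unfolding generalized_KKM_def
  proof (intro allI impI subsetI, elim conjE, rule ccontr)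
    fix B x
    assume B: "finite B" "B \<subseteq> Y"
      and x: "x \<in> (\<Union>y\<in>convex hull B. T y)" and notin: "x \<notin> (\<Union>y\<in>B. H y)"
    obtain y where y: "y \<in> convex hull B" "x \<in> T y"
      using x by blast
    have "y \<in> Y"
      using y(1) hull_minimal[of B Y convex] B(2) \<open>convex Y\<close> by blast
    then have meets: "P x \<inter> Q b \<noteq> {}" if "b \<in> B" for b
      using notin y(2) that by (auto simp: H_def)
    have "B \<noteq> {}"
      using y(1) by auto
    then obtain n :: nat and f where f: "n \<ge> 2" "f ` {1..n} = B"
      using finite_enumeration_at_least_two[OF B(1)] by metis
    then have "\<forall>i\<in>{1..n}. f i \<in> B"
      by blast
    then have "\<forall>i\<in>{1..n}. f i \<in> Y" "\<forall>i\<in>{1..n}. P x \<inter> Q (f i) \<noteq> {}"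
      using B(2) meets by blast+
    moreover have "y \<in> convex hull (f ` {1..n})"
      using y(1) f(2) by simp
    ultimately show False
      using contra f(1) y(2) by blast
  qed
  moreover have "Y \<noteq> {}"
    using assms(2) by blast
  ultimately obtain x where x: "\<And>y. y \<in> Y \<Longrightarrow> x \<in> closure (H y)"
    using KKM_compact_common_point[OF assms(4,5), of H] by (auto simp: H_def)
  obtain y' U where y': "y' \<in> Y" and U: "x \<in> interior U" "\<forall>x'\<in>U. P x' \<inter> Q y' \<noteq> {}"
    using assms(2,3) by meson
  have "interior U \<inter> H y' = {}"
    using U(2) interior_subset[of U] by (auto simp: H_def)
  then have "x \<notin> closure (H y')"
    using U(1) open_Int_closure_eq_empty[of "interior U" "H y'"] by auto
  then show False
    using x[OF y'] by blast
qed

end
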